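(* Let $H\in\mathbb{R}^{n\times n}$ be symmetric with positive diagonal, $x^*\in\mathbb{R}^n$, $f(x)=\tfrac12(x-x^* )^\top H(x-x^* )$. Fix $w\in\mathbb{R}^n_{>0}$ and $1/2\le\beta<1$, and set $$\theta_w(H)=\max_i\frac{\sum_{j\ne i}|H_{ij}|w_j}{H_{ii}w_i}.$$ Then the centres $c_k$ of Cube-Sign$(\beta,w)$ applied to $f$ converge to $x^*$ from every initial box $\mathcal{B}(c_0,r_0w)$ ($c_0\in\mathbb{R}^n$, $r_0>0$) containing $x^*$ and for every tie rule if and only if $$\theta_w(H)\le2\beta-1 .$$ Under this condition $H$ is positive definite and $M_k\le R_k=\beta^kr_0$ for all $k$, for every such initial box and every tie rule.
   Context: $\mathcal{B}(c,r)=\{x:|x_i-c_i|\le r_i\ \forall i\}$; $\|u\|_{\infty,w}=\max_i|u_i|/w_i$. Algorithm Cube-Sign$(\beta,w)$: from $c_0$, $r_0>0$, put $R_k=\beta^kr_0$. At step $k$ take $s_k\in\{-1,+1\}^n$ with $s_{k,i}=\operatorname{sign}\partial_if(c_k)$ whenever $\partial_if(c_k)\ne0$; if $\partial_if(c_k)=0$, $s_{k,i}\in\{-1,+1\}$ is chosen by a tie rule (any rule depending only on query points, sign answers and previous choices). Then $c_{k+1}=c_k-(1-\beta)R_k\,w\odot s_k$ (componentwise product). $M_k=\|c_k-x^*\|_{\infty,w}$. *)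

theory Defs
  imports "HOL-Analysis.Analysis"
begin

definition box_inf :: "real^'n \<Rightarrow> real^'n \<Rightarrow> (real^'n) set" where
  "box_inf c r = {x. \<forall>i. \<bar>x $ i - c $ i\<bar> \<le> r $ i}"

definition weighted_sup_norm :: "real^'n \<Rightarrow> real^'n \<Rightarrow> real" where
  "weighted_sup_norm w u = (MAX i. \<bar>u $ i\<bar> / w $ i)"

definition theta :: "real^'n \<Rightarrow> real^'n^'n \<Rightarrow> real" where
  "theta w H = (MAX i. (\<Sum>j\<in>UNIV - {i}. \<bar>H $ i $ j\<bar> * w $ j) / (H $ i $ i * w $ i))"

definition positive_definite :: "real^'n^'n \<Rightarrow> bool" where
  "positive_definite H \<longleftrightarrow> transpose H = H \<and> (\<forall>x. x \<noteq> 0 \<longrightarrow> x \<bullet> (H *v x) > 0)"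

definition quadratic :: "real^'n^'n \<Rightarrow> real^'n \<Rightarrow> real^'n \<Rightarrow> real" where
  "quadratic H xs x = 1 / 2 * ((x - xs) \<bullet> (H *v (x - xs)))"

definition partial_deriv :: "(real^'n \<Rightarrow> real) \<Rightarrow> 'n \<Rightarrow> real^'n \<Rightarrow> real" where
  "partial_deriv f i x = deriv (\<lambda>t. f (x + t *\<^sub>R axis i 1)) 0"

definition sign_answer :: "(real^'n \<Rightarrow> real) \<Rightarrow> real^'n \<Rightarrow> real^'n" where
  "sign_answer f x = (\<chi> i. sgn (partial_deriv f i x))"

text \<open>A transcript lists, oldest first, the completed steps as triples
  (query point, sign answer, chosen sign vector). A tie rule proposes a sign
  vector from the transcript of the previous steps, the current query point and
  the current sign answer; only its entries at coordinates where the answer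
  is 0 are used by the algorithm.\<close>

type_synonym 'n transcript = "((real^'n) \<times> (real^'n) \<times> (real^'n)) list"
type_synonym 'n tie_rule = "'n transcript \<Rightarrow> real^'n \<Rightarrow> real^'n \<Rightarrow> real^'n"

definition is_tie_rule :: "'n::finite tie_rule \<Rightarrow> bool" where
  "is_tie_rule \<tau> \<longleftrightarrow> (\<forall>h c a i. \<tau> h c a $ i \<in> {-1, 1})"

definition chosen_signs ::
  "'n::finite tie_rule \<Rightarrow> 'n transcript \<Rightarrow> real^'n \<Rightarrow> real^'n \<Rightarrow> real^'n" where
  "chosen_signs \<tau> h c a = (\<chi> i. if a $ i \<noteq> 0 then a $ i else \<tau> h c a $ i)"

definition radius :: "real \<Rightarrow> real \<Rightarrow> nat \<Rightarrow> real" where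
  "radius \<beta> r0 k = \<beta> ^ k * r0"

text \<open>The state before step \<open>k\<close>: the transcript of steps \<open>0, \<dots>, k - 1\<close>
  together with the centre \<open>c\<^sub>k\<close>.\<close>

primrec cube_sign_state ::
  "(real^'n \<Rightarrow> real) \<Rightarrow> real \<Rightarrow> real^'n \<Rightarrow> 'n::finite tie_rule \<Rightarrow> real^'n \<Rightarrow> real \<Rightarrow> nat
     \<Rightarrow> 'n transcript \<times> (real^'n)" where
  "cube_sign_state f \<beta> w \<tau> c0 r0 0 = ([], c0)"
| "cube_sign_state f \<beta> w \<tau> c0 r0 (Suc k) =
     (let (h, c) = cube_sign_state f \<beta> w \<tau> c0 r0 k;
          a = sign_answer f c;
          s = chosen_signs \<tau> h c a
      in (h @ [(c, a, s)], c - ((1 - \<beta>) * radius \<beta> r0 k) *\<^sub>R (w * s)))"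

definition cube_sign_centre ::
  "(real^'n \<Rightarrow> real) \<Rightarrow> real \<Rightarrow> real^'n \<Rightarrow> 'n::finite tie_rule \<Rightarrow> real^'n \<Rightarrow> real \<Rightarrow> nat \<Rightarrow> real^'n" where
  "cube_sign_centre f \<beta> w \<tau> c0 r0 k = snd (cube_sign_state f \<beta> w \<tau> c0 r0 k)"

end

theory Submission
  imports Defs
begin

text \<open>Write \<open>d = c - xs\<close>; the gradient of the quadratic at \<open>c\<close> is \<open>H *v d\<close>, and the
  quantity \<open>\<theta>\<close> is at most \<open>t\<close> exactly when every row of \<open>H\<close> satisfies the weighted
  diagonal dominance \<open>(\<Sum>j\<noteq>i. \<bar>H i j\<bar> * w j) \<le> t * H i i * w i\<close>.

  Sufficiency. Suppose \<open>xs\<close> lies in the box of radius \<open>R * w\<close> around \<open>c\<close>. Moving coordinate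
  \<open>i\<close> by \<open>(1 - \<beta>) * R * w i\<close> in the direction \<open>- s i\<close> leaves it within \<open>\<beta> * R * w i\<close> of
  \<open>xs i\<close> unless \<open>s i * d i < - (2 * \<beta> - 1) * R * w i\<close>. But \<open>s i\<close> never disagrees with the
  sign of \<open>(H *v d) i\<close>, and in that sum the off-diagonal terms contribute at most
  \<open>\<theta> * R * H i i * w i\<close>, so \<open>s i * d i \<ge> - \<theta> * R * w i\<close>. Hence \<open>\<theta> \<le> 2 * \<beta> - 1\<close> keeps
  \<open>xs\<close> in every box (\<open>box_invariant\<close>), and the boxes shrink to a point.

  Necessity. The steps from \<open>k\<close> onwards move coordinate \<open>i\<close> by at most
  \<open>w i * (\<Sum>m\<ge>k. (1 - \<beta>) * R\<^sub>m) = w i * R\<^sub>k\<close>, so a centre can converge to \<open>xs\<close> only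
  if \<open>xs\<close> never leaves the boxes (\<open>limit_in_every_box\<close>). If row \<open>i\<close> violates the dominance
  condition, one step is enough to lose \<open>xs\<close>: place the off-diagonal coordinates of \<open>d\<close> at
  the corners that make every term \<open>H i j * d j\<close> as large as possible, and \<open>d i\<close> at a
  negative value slightly below \<open>- (2 * \<beta> - 1) * w i\<close>. The derivative is then positive
  although \<open>d i < 0\<close>, so the step goes the wrong way and too far (\<open>bad_start\<close>).

  Positive definiteness is the classical fact that a symmetric matrix with positive diagonal
  and strict weighted diagonal dominance is positive definite.\<close>

section \<open>Weighted norms, boxes and diagonal dominance\<close>

lemma weighted_sup_norm_le_iff:
  fixes w u :: "real^'n"
  assumes "\<forall>i. w $ i > 0"
  shows "weighted_sup_norm w u \<le> R \<longleftrightarrow> (\<forall>i. \<bar>u $ i\<bar> \<le> R * w $ i)"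
  using assms by (simp add: weighted_sup_norm_def pos_divide_le_eq)

lemma theta_le_iff:
  fixes w :: "real^'n" and H :: "real^'n^'n"
  assumes "\<forall>i. w $ i > 0" and "\<forall>i. H $ i $ i > 0"
  shows "theta w H \<le> t \<longleftrightarrow>
    (\<forall>i. (\<Sum>j\<in>UNIV - {i}. \<bar>H $ i $ j\<bar> * w $ j) \<le> t * (H $ i $ i * w $ i))"
  using assms by (simp add: theta_def pos_divide_le_eq)

lemma mem_box_inf_scaled_iff:
  fixes c x w :: "real^'n"
  shows "x \<in> box_inf c (R *\<^sub>R w) \<longleftrightarrow> (\<forall>i. \<bar>(c - x) $ i\<bar> \<le> R * w $ i)"
  by (simp add: box_inf_def abs_minus_commute)

text \<open>By symmetry of \<open>H\<close> the bound \<open>\<bar>y i * y j\<bar> \<le> (y i ^ 2 + y j ^ 2) / 2\<close>, applied with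
  \<open>y i = x i / w i\<close>, charges half of each off-diagonal entry to its row and half to its
  column, that is, the whole off-diagonal sum of row \<open>i\<close> to \<open>y i ^ 2\<close>.\<close>

lemma positive_definite_of_dominance:
  fixes H :: "real^'n^'n" and w :: "real^'n"
  assumes sym: "transpose H = H" and w: "\<forall>i. w $ i > 0"
    and dom: "\<forall>i. (\<Sum>j\<in>UNIV - {i}. \<bar>H $ i $ j\<bar> * w $ j) < H $ i $ i * w $ i"
  shows "positive_definite H"
  unfolding positive_definite_def
proof (intro conjI allI impI)
  fix x :: "real^'n"
  assume "x \<noteq> 0"
  have symij: "H $ i $ j = H $ j $ i" for i j
    using sym by (metis transpose_def vec_lambda_beta)
  define y where "y i = x $ i / w $ i" for i
  have x: "x $ i = w $ i * y i" for i
    using w by (simp add: y_def less_imp_neq [THEN not_sym])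
  define a where "a i j = \<bar>H $ i $ j\<bar> * w $ i * w $ j" for i j
  have a_sym: "a i j = a j i" for i j
    by (simp add: a_def symij [of i j])
  have a_nonneg: "a i j \<ge> 0" for i j
    using w by (simp add: a_def less_imp_le)
  define offd where "offd i = UNIV - {i}" for i :: 'n
  have swap: "(\<Sum>i\<in>UNIV. \<Sum>j\<in>offd i. F j i) = (\<Sum>i\<in>UNIV. \<Sum>j\<in>offd i. F i j)"
    for F :: "'n \<Rightarrow> 'n \<Rightarrow> real"
  proof -
    have E: "(\<Sum>j\<in>offd i. G j) = (\<Sum>j\<in>UNIV. if j = i then 0 else G j)"
      for G :: "'n \<Rightarrow> real" and i
      unfolding offd_def by (intro sum.mono_neutral_cong_left) auto
    show ?thesis
      unfolding E by (subst sum.swap) (intro sum.cong refl, auto)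
  qed
  have "x \<bullet> (H *v x) = (\<Sum>i\<in>UNIV. \<Sum>j\<in>UNIV. x $ i * H $ i $ j * x $ j)"
    by (simp add: inner_vec_def matrix_vector_mult_def sum_distrib_left mult.assoc)
  also have "\<dots> = (\<Sum>i\<in>UNIV. H $ i $ i * (x $ i)\<^sup>2 + (\<Sum>j\<in>offd i. x $ i * H $ i $ j * x $ j))"
  proof (intro sum.cong refl)
    fix i
    show "(\<Sum>j\<in>UNIV. x $ i * H $ i $ j * x $ j)
        = H $ i $ i * (x $ i)\<^sup>2 + (\<Sum>j\<in>offd i. x $ i * H $ i $ j * x $ j)"
      by (simp add: offd_def sum.remove [of UNIV i] power2_eq_square)
  qed
  also have "\<dots> \<ge> (\<Sum>i\<in>UNIV. H $ i $ i * (x $ i)\<^sup>2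
                    - (\<Sum>j\<in>offd i. a i j * ((y i)\<^sup>2 + (y j)\<^sup>2) / 2))"
  proof (intro sum_mono)
    fix i
    have "- (a i j * ((y i)\<^sup>2 + (y j)\<^sup>2) / 2) \<le> x $ i * H $ i $ j * x $ j" for j
    proof -
      have "\<bar>y i * y j\<bar> \<le> ((y i)\<^sup>2 + (y j)\<^sup>2) / 2"
        using zero_le_power2 [of "\<bar>y i\<bar> - \<bar>y j\<bar>"]
        by (simp add: power2_diff abs_mult)
      then have "a i j * \<bar>y i * y j\<bar> \<le> a i j * (((y i)\<^sup>2 + (y j)\<^sup>2) / 2)"
        using a_nonneg by (intro mult_left_mono)
      moreover have "\<bar>x $ i * H $ i $ j * x $ j\<bar> = a i j * \<bar>y i * y j\<bar>"
        using w by (simp add: x a_def abs_mult less_imp_le)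
      ultimately show ?thesis by (simp add: abs_le_iff)
    qed
    then have "- (\<Sum>j\<in>offd i. a i j * ((y i)\<^sup>2 + (y j)\<^sup>2) / 2)
               \<le> (\<Sum>j\<in>offd i. x $ i * H $ i $ j * x $ j)"
      unfolding sum_negf [symmetric] by (intro sum_mono)
    then show "H $ i $ i * (x $ i)\<^sup>2 - (\<Sum>j\<in>offd i. a i j * ((y i)\<^sup>2 + (y j)\<^sup>2) / 2)
        \<le> H $ i $ i * (x $ i)\<^sup>2 + (\<Sum>j\<in>offd i. x $ i * H $ i $ j * x $ j)"
      by simp
  qed
  also have "(\<Sum>i\<in>UNIV. H $ i $ i * (x $ i)\<^sup>2
                - (\<Sum>j\<in>offd i. a i j * ((y i)\<^sup>2 + (y j)\<^sup>2) / 2))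
      = (\<Sum>i\<in>UNIV. H $ i $ i * (x $ i)\<^sup>2 - (\<Sum>j\<in>offd i. a i j * (y i)\<^sup>2))"
  proof -
    have "(\<Sum>i\<in>UNIV. \<Sum>j\<in>offd i. a i j * (y j)\<^sup>2) = (\<Sum>i\<in>UNIV. \<Sum>j\<in>offd i. a i j * (y i)\<^sup>2)"
      using swap [of "\<lambda>i j. a i j * (y i)\<^sup>2"] by (simp add: a_sym)
    moreover have "(\<Sum>j\<in>offd i. a i j * ((y i)\<^sup>2 + (y j)\<^sup>2) / 2)
        = (\<Sum>j\<in>offd i. a i j * (y i)\<^sup>2) / 2 + (\<Sum>j\<in>offd i. a i j * (y j)\<^sup>2) / 2" for i
      by (simp add: sum_divide_distrib sum.distrib [symmetric] field_simps)
    ultimately show ?thesis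
      by (simp add: sum_subtractf sum.distrib sum_divide_distrib [symmetric])
  qed
  also have "\<dots> = (\<Sum>i\<in>UNIV. w $ i * (y i)\<^sup>2 *
                (H $ i $ i * w $ i - (\<Sum>j\<in>offd i. \<bar>H $ i $ j\<bar> * w $ j)))"
    by (intro sum.cong refl)
       (simp add: a_def x power2_eq_square algebra_simps sum_distrib_left)
  finally have lower: "(\<Sum>i\<in>UNIV. w $ i * (y i)\<^sup>2 *
                (H $ i $ i * w $ i - (\<Sum>j\<in>offd i. \<bar>H $ i $ j\<bar> * w $ j))) \<le> x \<bullet> (H *v x)" .
  obtain k where "x $ k \<noteq> 0"
    using \<open>x \<noteq> 0\<close> by (metis vec_eq_iff zero_index)
  then have "y k \<noteq> 0" by (auto simp: x)
  have "0 < (\<Sum>i\<in>UNIV. w $ i * (y i)\<^sup>2 *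
                (H $ i $ i * w $ i - (\<Sum>j\<in>offd i. \<bar>H $ i $ j\<bar> * w $ j)))"
  proof (rule sum_pos2 [of UNIV k])
    show "0 < w $ k * (y k)\<^sup>2 * (H $ k $ k * w $ k - (\<Sum>j\<in>offd k. \<bar>H $ k $ j\<bar> * w $ j))"
      using w dom \<open>y k \<noteq> 0\<close> by (intro mult_pos_pos) (auto simp: offd_def)
    show "0 \<le> w $ i * (y i)\<^sup>2 * (H $ i $ i * w $ i - (\<Sum>j\<in>offd i. \<bar>H $ i $ j\<bar> * w $ j))" for i
      using w dom by (intro mult_nonneg_nonneg) (auto simp: offd_def less_imp_le)
  qed auto
  with lower show "x \<bullet> (H *v x) > 0" by linarith
qed (rule sym)

section \<open>The algorithm on a quadratic\<close>

lemma partial_deriv_quadratic: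
  fixes H :: "real^'n^'n"
  assumes "transpose H = H"
  shows "partial_deriv (quadratic H xs) i x = (H *v (x - xs)) $ i"
proof -
  define d where "d = x - xs"
  define e :: "real^'n" where "e = axis i 1"
  have e_inner: "e \<bullet> v = v $ i" for v
    by (simp add: e_def inner_axis')
  have self_adjoint: "d \<bullet> (H *v e) = e \<bullet> (H *v d)"
    using assms by (metis dot_lmul_matrix inner_commute transpose_matrix_vector)
  have expand: "quadratic H xs (x + t *\<^sub>R e)
      = 1 / 2 * (d \<bullet> (H *v d)) + t * (H *v d) $ i + t\<^sup>2 / 2 * (e \<bullet> (H *v e))" for t
  proof -
    have "x + t *\<^sub>R e - xs = d + t *\<^sub>R e" by (simp add: d_def)
    then show ?thesis
      by (simp add: quadratic_def matrix_vector_right_distrib matrix_vector_mult_scaleR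
          inner_add_left inner_add_right self_adjoint e_inner power2_eq_square algebra_simps)
  qed
  have "((\<lambda>t. quadratic H xs (x + t *\<^sub>R e)) has_field_derivative (H *v d) $ i) (at 0)"
    unfolding expand by (auto intro!: derivative_eq_intros)
  then show ?thesis
    unfolding partial_deriv_def d_def e_def by (rule DERIV_imp_deriv)
qed

text \<open>This hides the transcript and the tie rule: they matter only through a sign vector that
  never disagrees with the partial derivatives.\<close>

lemma cube_sign_centre_step:
  assumes "is_tie_rule \<tau>"
  obtains s where "\<And>i. s $ i = 1 \<or> s $ i = -1"
    and "\<And>i. s $ i * partial_deriv f i (cube_sign_centre f \<beta> w \<tau> c0 r0 k) \<ge> 0"
    and "\<And>i. cube_sign_centre f \<beta> w \<tau> c0 r0 (Suc k) $ i
           = cube_sign_centre f \<beta> w \<tau> c0 r0 k $ i - (1 - \<beta>) * radius \<beta> r0 k * w $ i * s $ i"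
proof -
  obtain h c where hc: "cube_sign_state f \<beta> w \<tau> c0 r0 k = (h, c)"
    by fastforce
  define s where "s = chosen_signs \<tau> h c (sign_answer f c)"
  have c: "cube_sign_centre f \<beta> w \<tau> c0 r0 k = c"
    by (simp add: cube_sign_centre_def hc)
  show thesis
  proof (rule that [of s])
    fix i
    have "\<tau> h c (sign_answer f c) $ i \<in> {-1, 1}"
      using assms unfolding is_tie_rule_def by blast
    then show "s $ i = 1 \<or> s $ i = -1"
      by (auto simp: s_def chosen_signs_def sign_answer_def sgn_if)
    show "s $ i * partial_deriv f i (cube_sign_centre f \<beta> w \<tau> c0 r0 k) \<ge> 0"
      by (auto simp: c s_def chosen_signs_def sign_answer_def sgn_if)
    show "cube_sign_centre f \<beta> w \<tau> c0 r0 (Suc k) $ i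
        = cube_sign_centre f \<beta> w \<tau> c0 r0 k $ i - (1 - \<beta>) * radius \<beta> r0 k * w $ i * s $ i"
      by (simp add: cube_sign_centre_def hc s_def Let_def mult.assoc)
  qed
qed

section \<open>Dominance keeps the minimiser in every box\<close>

text \<open>The agreement of \<open>s\<close> with the sign of row \<open>i\<close> of \<open>H *v d\<close> bounds \<open>s * d i\<close> from below
  by the off-diagonal part of that row, hence by \<open>- (2 * \<beta> - 1) * R * w i\<close>; this is what is
  needed for the step not to overshoot. On the other side, \<open>s * d i \<le> R * w i\<close> is enough.\<close>

lemma step_in_smaller_box:
  fixes H :: "real^'n^'n" and w d :: "real^'n"
  assumes diag: "H $ i $ i > 0" and s: "s = 1 \<or> s = -1"
    and dom: "(\<Sum>j\<in>UNIV - {i}. \<bar>H $ i $ j\<bar> * w $ j) \<le> (2 * \<beta> - 1) * (H $ i $ i * w $ i)"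
    and R: "R \<ge> 0" and d: "\<And>j. \<bar>d $ j\<bar> \<le> R * w $ j"
    and agree: "s * (H *v d) $ i \<ge> 0"
  shows "\<bar>d $ i - (1 - \<beta>) * R * w $ i * s\<bar> \<le> \<beta> * R * w $ i"
proof -
  have abs_s: "\<bar>s\<bar> = 1" using s by auto
  have "(H *v d) $ i = H $ i $ i * d $ i + (\<Sum>j\<in>UNIV - {i}. H $ i $ j * d $ j)"
    by (simp add: matrix_vector_mult_def sum.remove [of UNIV i])
  then have "- (s * (\<Sum>j\<in>UNIV - {i}. H $ i $ j * d $ j)) \<le> H $ i $ i * (s * d $ i)"
    using agree by (simp add: algebra_simps)
  moreover have "s * (\<Sum>j\<in>UNIV - {i}. H $ i $ j * d $ j)
      \<le> R * (\<Sum>j\<in>UNIV - {i}. \<bar>H $ i $ j\<bar> * w $ j)"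
    unfolding sum_distrib_left
  proof (rule sum_mono)
    fix j
    have "s * (H $ i $ j * d $ j) \<le> \<bar>s * (H $ i $ j * d $ j)\<bar>" by simp
    also have "\<dots> = \<bar>H $ i $ j\<bar> * \<bar>d $ j\<bar>" by (simp add: abs_mult abs_s)
    also have "\<dots> \<le> \<bar>H $ i $ j\<bar> * (R * w $ j)" by (intro mult_left_mono d) simp
    finally show "s * (H $ i $ j * d $ j) \<le> R * (\<bar>H $ i $ j\<bar> * w $ j)"
      by (simp add: algebra_simps)
  qed
  moreover have "R * (\<Sum>j\<in>UNIV - {i}. \<bar>H $ i $ j\<bar> * w $ j)
      \<le> R * ((2 * \<beta> - 1) * (H $ i $ i * w $ i))"
    using R dom by (rule mult_left_mono [rotated])
  ultimately have "H $ i $ i * (- ((2 * \<beta> - 1) * R * w $ i)) \<le> H $ i $ i * (s * d $ i)"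
    by (simp add: algebra_simps)
  then have "- ((2 * \<beta> - 1) * R * w $ i) \<le> s * d $ i"
    using diag by (simp only: mult_le_cancel_left_pos)
  then show ?thesis
    using s d [of i] by (auto simp: algebra_simps abs_le_iff)
qed

lemma box_invariant:
  fixes H :: "real^'n^'n" and w :: "real^'n"
  assumes sym: "transpose H = H" and diag: "\<forall>i. H $ i $ i > 0"
    and dom: "\<forall>i. (\<Sum>j\<in>UNIV - {i}. \<bar>H $ i $ j\<bar> * w $ j) \<le> (2 * \<beta> - 1) * (H $ i $ i * w $ i)"
    and "\<beta> \<ge> 0" and "r0 \<ge> 0" and tie: "is_tie_rule \<tau>"
    and start: "xs \<in> box_inf c0 (r0 *\<^sub>R w)"
  shows "xs \<in> box_inf (cube_sign_centre (quadratic H xs) \<beta> w \<tau> c0 r0 k) (radius \<beta> r0 k *\<^sub>R w)"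
proof (induction k)
  case 0
  show ?case using start by (simp add: cube_sign_centre_def radius_def)
next
  case (Suc k)
  let ?c = "cube_sign_centre (quadratic H xs) \<beta> w \<tau> c0 r0"
  obtain s where s: "\<And>i. s $ i = 1 \<or> s $ i = -1"
    and agree: "\<And>i. s $ i * partial_deriv (quadratic H xs) i (?c k) \<ge> 0"
    and step: "\<And>i. ?c (Suc k) $ i = ?c k $ i - (1 - \<beta>) * radius \<beta> r0 k * w $ i * s $ i"
    using cube_sign_centre_step [OF tie] by blast
  have R: "radius \<beta> r0 k \<ge> 0" using assms by (simp add: radius_def)
  show ?case
    unfolding mem_box_inf_scaled_iff
  proof
    fix i
    have "\<bar>(?c k - xs) $ i - (1 - \<beta>) * radius \<beta> r0 k * w $ i * s $ i\<bar>
        \<le> \<beta> * radius \<beta> r0 k * w $ i"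
      using Suc.IH agree [of i]
      by (intro step_in_smaller_box [OF diag [rule_format] s dom [rule_format] R])
         (auto simp: mem_box_inf_scaled_iff partial_deriv_quadratic [OF sym])
    then show "\<bar>(?c (Suc k) - xs) $ i\<bar> \<le> radius \<beta> r0 (Suc k) * w $ i"
      by (simp add: step radius_def algebra_simps)
  qed
qed

section \<open>A minimiser outside a box is never recovered\<close>

text \<open>The step at time \<open>m\<close> has length \<open>w i * (R\<^sub>m - R\<^sub>m\<^sub>+\<^sub>1)\<close> in coordinate \<open>i\<close>, so the lengths
  telescope.\<close>

lemma total_travel:
  fixes f :: "real^'n \<Rightarrow> real"
  assumes tie: "is_tie_rule \<tau>" and "0 \<le> \<beta>" "\<beta> \<le> 1" "r0 \<ge> 0" "w $ i \<ge> 0"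
  shows "\<bar>cube_sign_centre f \<beta> w \<tau> c0 r0 (k + m) $ i - cube_sign_centre f \<beta> w \<tau> c0 r0 k $ i\<bar>
    \<le> (radius \<beta> r0 k - radius \<beta> r0 (k + m)) * w $ i"
proof (induction m)
  case 0
  show ?case by simp
next
  case (Suc m)
  let ?c = "cube_sign_centre f \<beta> w \<tau> c0 r0"
  obtain s where s: "s $ i = 1 \<or> s $ i = -1"
    and step: "?c (Suc (k + m)) $ i
      = ?c (k + m) $ i - (1 - \<beta>) * radius \<beta> r0 (k + m) * w $ i * s $ i"
    using cube_sign_centre_step [OF tie] by metis
  have "0 \<le> (1 - \<beta>) * radius \<beta> r0 (k + m) * w $ i"
    using assms by (simp add: radius_def)
  then have "\<bar>?c (Suc (k + m)) $ i - ?c (k + m) $ i\<bar> \<le> (1 - \<beta>) * radius \<beta> r0 (k + m) * w $ i"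
    using s step by auto
  also have "\<dots> = (radius \<beta> r0 (k + m) - radius \<beta> r0 (Suc (k + m))) * w $ i"
    by (simp add: radius_def algebra_simps)
  finally show ?case
    using Suc.IH by (simp add: algebra_simps abs_le_iff)
qed

lemma limit_in_every_box:
  fixes f :: "real^'n \<Rightarrow> real"
  assumes tie: "is_tie_rule \<tau>" and \<beta>: "0 \<le> \<beta>" "\<beta> \<le> 1" and r0: "r0 \<ge> 0"
    and w: "\<forall>i. w $ i > 0"
    and lim: "cube_sign_centre f \<beta> w \<tau> c0 r0 \<longlonglongrightarrow> x"
  shows "x \<in> box_inf (cube_sign_centre f \<beta> w \<tau> c0 r0 k) (radius \<beta> r0 k *\<^sub>R w)"
proof -
  let ?c = "cube_sign_centre f \<beta> w \<tau> c0 r0"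
  have "\<bar>x $ i - ?c k $ i\<bar> \<le> radius \<beta> r0 k * w $ i" for i
  proof (rule tendsto_upperbound)
    show "(\<lambda>m. \<bar>?c (k + m) $ i - ?c k $ i\<bar>) \<longlonglongrightarrow> \<bar>x $ i - ?c k $ i\<bar>"
      using LIMSEQ_ignore_initial_segment [OF lim, of k]
      by (intro tendsto_intros) (simp add: add.commute)
    have "radius \<beta> r0 (k + m) * w $ i \<ge> 0" for m
      using assms by (simp add: radius_def less_imp_le)
    moreover have "\<bar>?c (k + m) $ i - ?c k $ i\<bar>
        \<le> (radius \<beta> r0 k - radius \<beta> r0 (k + m)) * w $ i" for m
      using tie \<beta> r0 w by (intro total_travel) (auto simp: less_imp_le)
    ultimately have "\<bar>?c (k + m) $ i - ?c k $ i\<bar> \<le> radius \<beta> r0 k * w $ i" for m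
      by (smt (verit) left_diff_distrib)
    then show "\<forall>\<^sub>F m in sequentially. \<bar>?c (k + m) $ i - ?c k $ i\<bar> \<le> radius \<beta> r0 k * w $ i"
      by simp
  qed simp
  then show ?thesis
    by (simp add: box_inf_def)
qed

text \<open>The starting point is the one described at the top, in the box of radius \<open>w\<close>; the tie
  rule is arbitrary because the decisive partial derivative is nonzero.\<close>

lemma bad_start:
  fixes H :: "real^'n^'n" and w :: "real^'n"
  assumes sym: "transpose H = H" and diag: "H $ i $ i > 0" and w: "\<forall>i. w $ i > 0"
    and \<beta>: "1 / 2 \<le> \<beta>" "\<beta> < 1"
    and viol: "(2 * \<beta> - 1) * (H $ i $ i * w $ i) < (\<Sum>j\<in>UNIV - {i}. \<bar>H $ i $ j\<bar> * w $ j)"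
  obtains c0 where "xs \<in> box_inf c0 (1 *\<^sub>R w)"
    and "\<And>\<tau>. is_tie_rule \<tau> \<Longrightarrow>
      xs \<notin> box_inf (cube_sign_centre (quadratic H xs) \<beta> w \<tau> c0 1 1) (radius \<beta> 1 1 *\<^sub>R w)"
proof -
  define S where "S = (\<Sum>j\<in>UNIV - {i}. \<bar>H $ i $ j\<bar> * w $ j)"
  have Hw: "H $ i $ i * w $ i > 0" using diag w by simp
  then have "2 * \<beta> - 1 < min 1 (S / (H $ i $ i * w $ i))"
    using viol \<beta> unfolding S_def by (simp only: min_less_iff_conj pos_less_divide_eq) simp
  \<comment> \<open>The bound by 1 keeps the start in the box; the other bound makes the derivative positive.\<close>
  then obtain \<delta> where \<delta>: "2 * \<beta> - 1 < \<delta>" "\<delta> < min 1 (S / (H $ i $ i * w $ i))"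
    using dense by blast
  then have \<delta>S: "\<delta> * (H $ i $ i * w $ i) < S"
    using Hw by (simp add: pos_less_divide_eq)
  define d :: "real^'n" where "d = (\<chi> j. if j = i then - \<delta> * w $ i else sgn (H $ i $ j) * w $ j)"
  define c0 where "c0 = xs + d"
  have "(H *v d) $ i = H $ i $ i * d $ i + (\<Sum>j\<in>UNIV - {i}. H $ i $ j * d $ j)"
    by (simp add: matrix_vector_mult_def sum.remove [of UNIV i])
  also have "(\<Sum>j\<in>UNIV - {i}. H $ i $ j * d $ j) = S"
    unfolding S_def by (intro sum.cong refl) (auto simp: d_def sgn_if)
  finally have grad: "(H *v d) $ i > 0"
    using \<delta>S by (simp add: d_def algebra_simps)
  show thesis
  proof (rule that [of c0])
    have "\<bar>d $ j\<bar> \<le> w $ j" for j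
      using \<delta> \<beta> w [rule_format, of j] by (auto simp: d_def abs_mult sgn_if)
    then show "xs \<in> box_inf c0 (1 *\<^sub>R w)"
      unfolding mem_box_inf_scaled_iff by (simp add: c0_def)
  next
    fix \<tau> :: "'n tie_rule"
    assume tie: "is_tie_rule \<tau>"
    let ?c = "cube_sign_centre (quadratic H xs) \<beta> w \<tau> c0 1"
    have c_0: "?c 0 = c0" by (simp add: cube_sign_centre_def)
    obtain s where s: "s $ i = 1 \<or> s $ i = -1"
      and agree: "s $ i * partial_deriv (quadratic H xs) i (?c 0) \<ge> 0"
      and step: "?c (Suc 0) $ i = ?c 0 $ i - (1 - \<beta>) * radius \<beta> 1 0 * w $ i * s $ i"
      using cube_sign_centre_step [OF tie] by metis
    have "s $ i = 1"
      using s agree [unfolded c_0] grad by (auto simp: c0_def partial_deriv_quadratic [OF sym])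
    then have "(?c 1 - xs) $ i = - ((\<delta> + (1 - \<beta>)) * w $ i)"
      using step [unfolded c_0] by (simp add: c0_def radius_def d_def algebra_simps)
    moreover have "\<beta> * w $ i < (\<delta> + (1 - \<beta>)) * w $ i"
      using \<delta> w by (intro mult_strict_right_mono) auto
    ultimately have "\<not> \<bar>(?c 1 - xs) $ i\<bar> \<le> radius \<beta> 1 1 * w $ i"
      by (simp add: radius_def)
    then show "xs \<notin> box_inf (?c 1) (radius \<beta> 1 1 *\<^sub>R w)"
      unfolding mem_box_inf_scaled_iff by blast
  qed
qed

section \<open>The convergence criterion\<close>

lemma tendsto_of_weighted_sup_norm_le_radius:
  fixes w x :: "real^'n"
  assumes w: "\<forall>i. w $ i > 0" and "0 \<le> \<beta>" "\<beta> < 1"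
    and bound: "\<And>k. weighted_sup_norm w (c k - x) \<le> radius \<beta> r0 k"
  shows "c \<longlonglongrightarrow> x"
proof (rule vec_tendstoI)
  fix i
  have shrink: "(\<lambda>k. radius \<beta> r0 k * w $ i) \<longlonglongrightarrow> 0 * r0 * w $ i"
    unfolding radius_def using assms
    by (intro tendsto_mult tendsto_const LIMSEQ_power_zero) simp
  have "\<forall>k. norm ((c k - x) $ i) \<le> radius \<beta> r0 k * w $ i"
    using bound by (simp add: weighted_sup_norm_le_iff [OF w])
  then have "(\<lambda>k. (c k - x) $ i) \<longlonglongrightarrow> 0"
    by (rule Lim_null_comparison [OF always_eventually shrink [simplified]])
  then show "(\<lambda>k. c k $ i) \<longlonglongrightarrow> x $ i"
    by (simp add: LIM_zero_iff)
qed

theorem theorem4p3: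
  fixes H :: "real^'n^'n" and xs w :: "real^'n" and \<beta> :: real
  assumes "transpose H = H"
    and "\<forall>i. H $ i $ i > 0"
    and "\<forall>i. w $ i > 0"
    and "1 / 2 \<le> \<beta>" and "\<beta> < 1"
  shows
    "((\<forall>c0 r0 \<tau>. r0 > 0 \<longrightarrow> xs \<in> box_inf c0 (r0 *\<^sub>R w) \<longrightarrow> is_tie_rule \<tau> \<longrightarrow>
          cube_sign_centre (quadratic H xs) \<beta> w \<tau> c0 r0 \<longlonglongrightarrow> xs)
        \<longleftrightarrow> theta w H \<le> 2 * \<beta> - 1)
     \<and> (theta w H \<le> 2 * \<beta> - 1 \<longrightarrow>
          positive_definite H \<and>
          (\<forall>c0 r0 \<tau>. r0 > 0 \<longrightarrow> xs \<in> box_inf c0 (r0 *\<^sub>R w) \<longrightarrow> is_tie_rule \<tau> \<longrightarrow>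
             (\<forall>k. weighted_sup_norm w (cube_sign_centre (quadratic H xs) \<beta> w \<tau> c0 r0 k - xs)
                    \<le> radius \<beta> r0 k)))"
proof -
  note dominance = theta_le_iff [OF assms(3) assms(2), of "2 * \<beta> - 1"]
  have bound: "weighted_sup_norm w (cube_sign_centre (quadratic H xs) \<beta> w \<tau> c0 r0 k - xs)
      \<le> radius \<beta> r0 k"
    if "theta w H \<le> 2 * \<beta> - 1" "r0 > 0" "xs \<in> box_inf c0 (r0 *\<^sub>R w)" "is_tie_rule \<tau>"
    for c0 r0 \<tau> k
    using box_invariant [OF assms(1,2), of w \<beta> r0 \<tau> xs c0 k] that assms(4) dominance
    by (simp add: weighted_sup_norm_le_iff [OF assms(3)] mem_box_inf_scaled_iff)
  have sufficient: "cube_sign_centre (quadratic H xs) \<beta> w \<tau> c0 r0 \<longlonglongrightarrow> xs"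
    if "theta w H \<le> 2 * \<beta> - 1" "r0 > 0" "xs \<in> box_inf c0 (r0 *\<^sub>R w)" "is_tie_rule \<tau>"
    for c0 r0 \<tau>
    using tendsto_of_weighted_sup_norm_le_radius [OF assms(3) _ _ bound [OF that]] assms by simp
  have necessary: "theta w H \<le> 2 * \<beta> - 1"
    if conv: "\<forall>c0 r0 \<tau>. r0 > 0 \<longrightarrow> xs \<in> box_inf c0 (r0 *\<^sub>R w) \<longrightarrow> is_tie_rule \<tau> \<longrightarrow>
          cube_sign_centre (quadratic H xs) \<beta> w \<tau> c0 r0 \<longlonglongrightarrow> xs"
  proof (rule ccontr)
    assume "\<not> theta w H \<le> 2 * \<beta> - 1"
    then obtain i where
      viol: "(2 * \<beta> - 1) * (H $ i $ i * w $ i) < (\<Sum>j\<in>UNIV - {i}. \<bar>H $ i $ j\<bar> * w $ j)"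
      unfolding dominance by (auto simp: not_le)
    define \<tau> :: "'n tie_rule" where "\<tau> = (\<lambda>h c a. \<chi> i. 1)"
    have tie: "is_tie_rule \<tau>" by (simp add: is_tie_rule_def \<tau>_def)
    obtain c0 where start: "xs \<in> box_inf c0 (1 *\<^sub>R w)"
      and lost: "xs \<notin> box_inf (cube_sign_centre (quadratic H xs) \<beta> w \<tau> c0 1 1)
        (radius \<beta> 1 1 *\<^sub>R w)"
      using bad_start [OF assms(1) assms(2) [rule_format] assms(3-5) viol, of xs] tie by metis
    have "cube_sign_centre (quadratic H xs) \<beta> w \<tau> c0 1 \<longlonglongrightarrow> xs"
      using conv start tie by (meson zero_less_one)
    then show False
      using limit_in_every_box [OF tie] assms lost by auto
  qed
  have "positive_definite H" if "theta w H \<le> 2 * \<beta> - 1"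
  proof (rule positive_definite_of_dominance [OF assms(1,3)], rule allI)
    fix i
    have "(\<Sum>j\<in>UNIV - {i}. \<bar>H $ i $ j\<bar> * w $ j) \<le> (2 * \<beta> - 1) * (H $ i $ i * w $ i)"
      using that dominance by blast
    also have "\<dots> < 1 * (H $ i $ i * w $ i)"
      using assms by (intro mult_strict_right_mono) auto
    finally show "(\<Sum>j\<in>UNIV - {i}. \<bar>H $ i $ j\<bar> * w $ j) < H $ i $ i * w $ i" by simp
  qed
  then show ?thesis
    using necessary sufficient bound by blast
qed

end
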